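(* Let $Q(t)\in\mathbb{H}[t]\setminus\mathbb{C}[t]$ be a monic polynomial of degree $n\ge 1$, written as $Q(t)=f(t)+\mathbf{k}\,g(t)$ with $f(t),g(t)\in\mathbb{C}[t]$. Then $Q(t)$ has a complex root (a root lying in $\mathbb{C}$) if and only if $R(f,g)=0$, or equivalently, if and only if $\operatorname{bez}(f,g)=0$.
   Context: $\mathbb{H}$ is the skew field of real quaternions $x_0+x_1\mathbf{i}+x_2\mathbf{j}+x_3\mathbf{k}$, and $\mathbb{C}=\mathbb{R}+\mathbb{R}\mathbf{i}\subset\mathbb{H}$. In $\mathbb{H}[t]$ the variable $t$ commutes with the coefficients; for $P(t)=a_0t^n+a_1t^{n-1}+\cdots+a_n$ and $q\in\mathbb{H}$ the evaluation is $P(q)=a_0q^n+a_1q^{n-1}+\cdots+a_n$, and $q$ is a root of $P$ if $P(q)=0$. Every $Q\in\mathbb{H}[t]$ is uniquely $f+\mathbf{k}g$ with $f,g\in\mathbb{C}[t]$; for $Q$ monic of degree $n\ge 1$ and not in $\mathbb{C}[t]$, $f$ and $g$ are nonzero, $\deg f=n$ and $\deg g<n$. $R(f,g)$ denotes the Sylvester resultant of $f$ and $g$. For a field $F$ of characteristic zero and $P,S\in F[x]$ with $d=\max\{\deg P,\deg S\}$, write $\frac{P(x)S(y)-P(y)S(x)}{x-y}=\sum_{i,j=0}^{d-1}c_{i,j}x^iy^j$; the Bézout matrix is $\operatorname{Bez}(P,S)=(c_{i,j})_{0\le i,j\le d-1}$ and the Bezoutian is $\operatorname{bez}(P,S)=\det\operatorname{Bez}(P,S)$.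 *)

theory Defs
  imports Complex_Main "Subresultants.Resultant_Prelim"
begin

section \<open>Real quaternions\<close>

datatype quat = Quat (qRe: real) (qI: real) (qJ: real) (qK: real)

lemma quat_eq_iff:
  "p = q \<longleftrightarrow> qRe p = qRe q \<and> qI p = qI q \<and> qJ p = qJ q \<and> qK p = qK q"
  by (cases p; cases q) simp

definition qnorm2 :: "quat \<Rightarrow> real" where
  "qnorm2 q = (qRe q)\<^sup>2 + (qI q)\<^sup>2 + (qJ q)\<^sup>2 + (qK q)\<^sup>2"

lemma qnorm2_eq_0_iff:
  "qnorm2 q = 0 \<longleftrightarrow> qRe q = 0 \<and> qI q = 0 \<and> qJ q = 0 \<and> qK q = 0"
  by (auto simp: qnorm2_def add_nonneg_eq_0_iff)

instantiation quat :: division_ring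
begin

definition zero_quat :: quat where "0 = Quat 0 0 0 0"

definition one_quat :: quat where "1 = Quat 1 0 0 0"

definition plus_quat :: "quat \<Rightarrow> quat \<Rightarrow> quat" where
  "p + q = Quat (qRe p + qRe q) (qI p + qI q) (qJ p + qJ q) (qK p + qK q)"

definition minus_quat :: "quat \<Rightarrow> quat \<Rightarrow> quat" where
  "p - q = Quat (qRe p - qRe q) (qI p - qI q) (qJ p - qJ q) (qK p - qK q)"

definition uminus_quat :: "quat \<Rightarrow> quat" where
  "- p = Quat (- qRe p) (- qI p) (- qJ p) (- qK p)"

definition times_quat :: "quat \<Rightarrow> quat \<Rightarrow> quat" where
  "p * q = Quat
     (qRe p * qRe q - qI p * qI q - qJ p * qJ q - qK p * qK q)
     (qRe p * qI q + qI p * qRe q + qJ p * qK q - qK p * qJ q)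
     (qRe p * qJ q - qI p * qK q + qJ p * qRe q + qK p * qI q)
     (qRe p * qK q + qI p * qJ q - qJ p * qI q + qK p * qRe q)"

definition inverse_quat :: "quat \<Rightarrow> quat" where
  "inverse p = Quat (qRe p / qnorm2 p) (- qI p / qnorm2 p) (- qJ p / qnorm2 p) (- qK p / qnorm2 p)"

definition divide_quat :: "quat \<Rightarrow> quat \<Rightarrow> quat" where
  "p div q = p * inverse (q :: quat)"

instance
proof
  fix a b c :: quat
  show "a + b + c = a + (b + c)" "a + b = b + a" "0 + a = a" "- a + a = 0" "a - b = a + - b"
    by (simp_all add: quat_eq_iff plus_quat_def minus_quat_def uminus_quat_def zero_quat_def)
  show "a * b * c = a * (b * c)" "(a + b) * c = a * c + b * c" "a * (b + c) = a * b + a * c"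
    by (simp_all add: quat_eq_iff plus_quat_def times_quat_def algebra_simps)
  show "1 * a = a" "a * 1 = a" "(0::quat) \<noteq> 1"
    by (simp_all add: quat_eq_iff times_quat_def one_quat_def zero_quat_def)
  show "a div b = a * inverse b" by (simp add: divide_quat_def)
  show "inverse (0::quat) = 0"
    by (simp add: inverse_quat_def zero_quat_def)
  assume "a \<noteq> 0"
  then have "qnorm2 a \<noteq> 0"
    by (simp add: qnorm2_eq_0_iff quat_eq_iff zero_quat_def)
  moreover have "x / N * y = x * y / N" for x y N :: real by simp
  ultimately show "inverse a * a = 1" "a * inverse a = 1"
    by (simp_all add: quat_eq_iff times_quat_def one_quat_def inverse_quat_def
          add_divide_distrib[symmetric] diff_divide_distrib[symmetric])
       (simp_all add: qnorm2_def power2_eq_square mult.commute)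
qed

end

definition quat_i :: quat where "quat_i = Quat 0 1 0 0"
definition quat_j :: quat where "quat_j = Quat 0 0 1 0"
definition quat_k :: quat where "quat_k = Quat 0 0 0 1"

lemma quat_unit_products:
  "quat_i * quat_i = -1" "quat_j * quat_j = -1" "quat_k * quat_k = -1"
  "quat_i * quat_j = quat_k" "quat_j * quat_k = quat_i" "quat_k * quat_i = quat_j"
  "quat_j * quat_i = - quat_k" "quat_k * quat_j = - quat_i" "quat_i * quat_k = - quat_j"
  by (simp_all add: quat_eq_iff quat_i_def quat_j_def quat_k_def times_quat_def uminus_quat_def
        one_quat_def)

definition quat_of_complex :: "complex \<Rightarrow> quat" where
  "quat_of_complex z = Quat (Re z) (Im z) 0 0"

lemma quat_of_complex_0 [simp]: "quat_of_complex 0 = 0"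
  by (simp add: quat_of_complex_def zero_quat_def)

lemma quat_of_complex_hom:
  "quat_of_complex 1 = 1"
  "quat_of_complex \<i> = quat_i"
  "quat_of_complex (x + y) = quat_of_complex x + quat_of_complex y"
  "quat_of_complex (x * y) = quat_of_complex x * quat_of_complex y"
  by (simp_all add: quat_of_complex_def quat_eq_iff one_quat_def quat_i_def plus_quat_def
        times_quat_def)

definition complex_quats :: "quat set" where
  "complex_quats = range quat_of_complex"

section \<open>Quaternionic polynomials\<close>

text \<open>The library functions \<open>poly\<close> and \<open>smult\<close> need commutative coefficients, so evaluation
  (coefficients to the left of the powers) and multiplication by a scalar from the left are
  defined here.\<close>

definition quat_poly_eval :: "quat poly \<Rightarrow> quat \<Rightarrow> quat" where
  "quat_poly_eval P q = (\<Sum>i\<le>degree P. coeff P i * q ^ i)"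

definition quat_left_smult :: "quat \<Rightarrow> quat poly \<Rightarrow> quat poly" where
  "quat_left_smult c P = map_poly (\<lambda>a. c * a) P"

definition quat_poly_of_complex :: "complex poly \<Rightarrow> quat poly" where
  "quat_poly_of_complex f = map_poly quat_of_complex f"

definition complex_quat_polys :: "quat poly set" where
  "complex_quat_polys = range quat_poly_of_complex"

lemma coeff_quat_poly_of_complex [simp]:
  "coeff (quat_poly_of_complex f) i = quat_of_complex (coeff f i)"
  by (simp add: quat_poly_of_complex_def coeff_map_poly)

lemma coeff_quat_left_smult [simp]: "coeff (quat_left_smult c P) i = c * coeff P i"
  by (simp add: quat_left_smult_def coeff_map_poly)

lemma quat_poly_decomposition:
  "\<exists>!(f, g). Q = quat_poly_of_complex f + quat_left_smult quat_k (quat_poly_of_complex g)"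
proof -
  define f where "f = map_poly (\<lambda>q. Complex (qRe q) (qI q)) Q"
  define g where "g = map_poly (\<lambda>q. Complex (qK q) (qJ q)) Q"
  have z: "Complex (qRe 0) (qI 0) = 0" "Complex (qK 0) (qJ 0) = 0"
    by (simp_all add: zero_quat_def complex_eq_iff)
  have fg: "Q = quat_poly_of_complex u + quat_left_smult quat_k (quat_poly_of_complex v)
      \<longleftrightarrow> u = f \<and> v = g" for u v
    by (simp add: poly_eq_iff f_def g_def coeff_map_poly z quat_eq_iff complex_eq_iff
          plus_quat_def times_quat_def quat_k_def quat_of_complex_def) metis
  show ?thesis
    by (rule ex1I[of _ "(f, g)"]) (auto simp: fg)
qed

section \<open>Bezoutian\<close>

text \<open>Polynomials in \<open>x\<close> and \<open>y\<close> are polynomials in \<open>y\<close> whose coefficients are polynomials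
  in \<open>x\<close>: the coefficient of \<open>x\<^sup>i y\<^sup>j\<close> in \<open>B\<close> is \<open>coeff (coeff B j) i\<close>.\<close>

definition poly_in_x :: "'a::comm_ring_1 poly \<Rightarrow> 'a poly poly" where
  "poly_in_x P = [:P:]"

definition poly_in_y :: "'a::comm_ring_1 poly \<Rightarrow> 'a poly poly" where
  "poly_in_y P = map_poly (\<lambda>c. [:c:]) P"

definition bezout_numerator :: "'a::field_char_0 poly \<Rightarrow> 'a poly \<Rightarrow> 'a poly poly" where
  "bezout_numerator P S = poly_in_x P * poly_in_y S - poly_in_y P * poly_in_x S"

definition x_minus_y :: "'a::field_char_0 poly poly" where
  "x_minus_y = poly_in_x [:0, 1:] - poly_in_y [:0, 1:]"

definition bezout_quotient :: "'a::field_char_0 poly \<Rightarrow> 'a poly \<Rightarrow> 'a poly poly" where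
  "bezout_quotient P S = bezout_numerator P S div x_minus_y"

text \<open>The division is exact.\<close>

lemma bezout_quotient_mult:
  "bezout_quotient P S * x_minus_y = bezout_numerator P S"
proof -
  have x: "x_minus_y = - [:- [:0, 1:], 1 :: 'a poly:]"
    by (simp add: x_minus_y_def poly_in_x_def poly_in_y_def map_poly_pCons one_pCons)
  have "poly (poly_in_y R) [:0, 1:] = R" for R :: "'a poly"
    by (induction R) (simp_all add: poly_in_y_def map_poly_pCons)
  then have "poly (bezout_numerator P S) [:0, 1:] = 0"
    by (simp add: bezout_numerator_def poly_in_x_def)
  then have "x_minus_y dvd bezout_numerator P S"
    unfolding x minus_dvd_iff by (simp only: poly_eq_0_iff_dvd)
  then show ?thesis
    by (simp add: bezout_quotient_def)
qed

definition bezout_mat :: "'a::field_char_0 poly \<Rightarrow> 'a poly \<Rightarrow> 'a mat" where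
  "bezout_mat P S =
     (let d = max (degree P) (degree S)
      in mat d d (\<lambda>(i, j). coeff (coeff (bezout_quotient P S) j) i))"

definition bezoutian :: "'a::field_char_0 poly \<Rightarrow> 'a poly \<Rightarrow> 'a" where
  "bezoutian P S = det (bezout_mat P S)"

end

(* For complex z the coefficients of Q act by Q(z) = f(z) + k g(z), so complex roots of Q are the
   common roots of f and g. By the fundamental theorem of algebra these exist iff gcd f g is
   nonconstant, which the resultant detects.

   For the Bezoutian write B = (P(x)S(y) - P(y)S(x))/(x - y) = sum_j b_j(x) y^j. Comparing
   coefficients of y^j gives x b_j - b_{j-1} = S_j P - P_j S. Weighting these relations with z^j
   shows that a common root z yields the kernel vector (z^j)_j. Conversely, a kernel vector v defines
   the linear functional L on polynomials with L(y^j) = v_j for j < deg P that vanishes on the ideal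
   (P). Weighting with L(y^(m+j)) shows by induction on m, comparing degrees in x, that L also kills
   y^m S. Hence L vanishes on the ideal (P, S), and v = 0 if that is everything. *)

theory Submission
  imports Defs "Subresultants.Subresultant_Gcd" "HOL-Computational_Algebra.Field_as_Ring"
    "HOL-Computational_Algebra.Fundamental_Theorem_Algebra"
begin

section \<open>The coefficients of the Bezout quotient as a polynomial in y\<close>

lemma poly_eq_sum_atMost:
  fixes p :: "'a::comm_semiring_1 poly"
  assumes "degree p \<le> n"
  shows "poly p x = (\<Sum>i\<le>n. coeff p i * x ^ i)"
  unfolding poly_altdef using assms by (intro sum.mono_neutral_left) (auto simp: coeff_eq_0)

text \<open>Compares coefficients of y^j in \<open>bezout_quotient_mult\<close>. Multiplication by x
  acts on a coefficient as \<open>pCons 0\<close>; multiplication by y shifts the index, which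
  leaves nothing to subtract at j = 0.\<close>

lemma coeff_bezout_quotient:
  fixes P S :: "'a::field_char_0 poly"
  shows "pCons 0 (coeff (bezout_quotient P S) j)
      - (case j of 0 \<Rightarrow> 0 | Suc k \<Rightarrow> coeff (bezout_quotient P S) k)
    = smult (coeff S j) P - smult (coeff P j) S"
proof -
  have x: "x_minus_y = [:[:0, 1:], - 1 :: 'a poly:]"
    by (simp add: x_minus_y_def poly_in_x_def poly_in_y_def map_poly_pCons
        poly_eq_iff[of "- 1"] coeff_pCons split: nat.split)
  have "coeff (bezout_quotient P S * x_minus_y) j
      = pCons 0 (coeff (bezout_quotient P S) j)
        - (case j of 0 \<Rightarrow> 0 | Suc k \<Rightarrow> coeff (bezout_quotient P S) k)"
    by (simp add: x mult.commute[of _ "pCons _ _"] mult_pCons_left coeff_pCons split: nat.split)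
  moreover have "coeff (bezout_numerator P S) j = smult (coeff S j) P - smult (coeff P j) S"
    by (simp add: bezout_numerator_def poly_in_x_def poly_in_y_def coeff_map_poly
        mult.commute[of _ "[:S:]"] mult.commute[of S] mult.commute[of P])
  ultimately show ?thesis
    by (simp add: bezout_quotient_mult)
qed

text \<open>By induction on j, the recurrence bounds the degree of x b_j by that of P, and removing
  the factor x lowers the degree by one.\<close>

lemma degree_coeff_bezout_quotient:
  fixes P S :: "'a::field_char_0 poly"
  assumes "degree S \<le> degree P" "degree P > 0"
  shows "degree (coeff (bezout_quotient P S) j) < degree P"
proof (induction j)
  case 0
  have "degree (pCons 0 (coeff (bezout_quotient P S) 0)) \<le> degree P"
    using coeff_bezout_quotient[of P S 0] assms
    by (simp add: degree_diff_le)
  then show ?case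
    using assms by (simp add: degree_pCons_eq_if split: if_splits)
next
  case (Suc j)
  have "pCons 0 (coeff (bezout_quotient P S) (Suc j))
      = coeff (bezout_quotient P S) j + (smult (coeff S (Suc j)) P - smult (coeff P (Suc j)) S)"
    using coeff_bezout_quotient[of P S "Suc j"] by (simp add: algebra_simps)
  moreover have "degree (coeff (bezout_quotient P S) j
      + (smult (coeff S (Suc j)) P - smult (coeff P (Suc j)) S)) \<le> degree P"
    using Suc assms by (intro degree_add_le degree_diff_le) auto
  ultimately have "degree (pCons 0 (coeff (bezout_quotient P S) (Suc j))) \<le> degree P"
    by simp
  then show ?case
    using assms by (simp add: degree_pCons_eq_if split: if_splits)
qed

lemma coeff_bezout_quotient_eq_0:
  fixes P S :: "'a::field_char_0 poly"
  assumes "degree S \<le> degree P" "degree P \<le> j"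
  shows "coeff (bezout_quotient P S) j = 0"
proof (rule ccontr)
  assume "coeff (bezout_quotient P S) j \<noteq> 0"
  then have j: "j \<le> degree (bezout_quotient P S)" and nz: "bezout_quotient P S \<noteq> 0"
    by (auto simp: le_degree)
  then have "coeff (bezout_quotient P S) (degree (bezout_quotient P S)) \<noteq> 0"
    by simp
  \<comment> \<open>One index above the degree of the quotient, every other term of the recurrence
    vanishes.\<close>
  moreover have "coeff (bezout_quotient P S) (degree (bezout_quotient P S)) = 0"
    using coeff_bezout_quotient[of P S "Suc (degree (bezout_quotient P S))"] j assms
    by (simp add: coeff_eq_0)
  ultimately show False by simp
qed

text \<open>The recurrences for b_j are multiplied by weights and added. The weights stay arbitrary
  because they are later powers of a common root or values of a linear functional.\<close>

lemma bezout_quotient_weighted_sum: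
  fixes P S :: "'a::field_char_0 poly"
  assumes "degree S \<le> degree P"
  shows "pCons 0 (\<Sum>j<degree P. smult (c j) (coeff (bezout_quotient P S) j))
      - (\<Sum>j<degree P. smult (c (Suc j)) (coeff (bezout_quotient P S) j))
    = smult (\<Sum>j\<le>degree P. c j * coeff S j) P - smult (\<Sum>j\<le>degree P. c j * coeff P j) S"
proof -
  let ?n = "degree P" and ?b = "coeff (bezout_quotient P S)"
  have "(\<Sum>j\<le>?n. smult (c j) (pCons 0 (?b j) - (case j of 0 \<Rightarrow> 0 | Suc k \<Rightarrow> ?b k)))
      = (\<Sum>j\<le>?n. pCons 0 (smult (c j) (?b j)))
        - (\<Sum>j\<le>?n. smult (c j) (case j of 0 \<Rightarrow> 0 | Suc k \<Rightarrow> ?b k))"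
    by (simp add: smult_diff_right sum_subtractf)
  \<comment> \<open>The term j = \<open>?n\<close> drops out since b_j = 0 from there on.\<close>
  also have "(\<Sum>j\<le>?n. pCons 0 (smult (c j) (?b j))) = pCons 0 (\<Sum>j<?n. smult (c j) (?b j))"
    using assms
    by (simp add: lessThan_Suc_atMost[symmetric] coeff_bezout_quotient_eq_0 poly_eq_iff coeff_sum
        coeff_pCons split: nat.split)
  also have "(\<Sum>j\<le>?n. smult (c j) (case j of 0 \<Rightarrow> 0 | Suc k \<Rightarrow> ?b k))
      = (\<Sum>j<?n. smult (c (Suc j)) (?b j))"
    by (simp add: lessThan_Suc_atMost[symmetric] sum.lessThan_Suc_shift del: sum.lessThan_Suc)
  finally show ?thesis
    by (simp add: coeff_bezout_quotient smult_diff_right sum_subtractf smult_sum)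
qed

section \<open>The kernel of the Bezout matrix\<close>

lemma bezout_mat_mult_vec_eq_0_iff:
  fixes P S :: "'a::field_char_0 poly"
  assumes "degree S \<le> degree P" "degree P > 0" "v \<in> carrier_vec (degree P)"
  shows "bezout_mat P S *\<^sub>v v = 0\<^sub>v (degree P)
    \<longleftrightarrow> (\<Sum>j<degree P. smult (v $ j) (coeff (bezout_quotient P S) j)) = 0"
proof -
  let ?n = "degree P" and ?b = "coeff (bezout_quotient P S)"
  let ?p = "\<Sum>j<?n. smult (v $ j) (?b j)"
  have n: "max ?n (degree S) = ?n"
    using assms by simp
  \<comment> \<open>Column j of the matrix lists the coefficients of b_j.\<close>
  have p: "bezout_mat P S *\<^sub>v v = vec ?n (coeff ?p)"
  proof (rule eq_vecI)
    fix i assume "i < dim_vec (vec ?n (coeff ?p))"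
    with assms(3) show "(bezout_mat P S *\<^sub>v v) $ i = vec ?n (coeff ?p) $ i"
      by (simp add: bezout_mat_def n Let_def scalar_prod_def coeff_sum lessThan_atLeast0 mult.commute)
  qed (simp add: bezout_mat_def n Let_def)
  have "degree ?p < ?n"
    using assms degree_coeff_bezout_quotient[OF assms(1,2)]
    by (intro degree_sum_less) (auto intro: le_less_trans[OF degree_smult_le])
  then have "coeff ?p i = 0" if "\<not> i < ?n" for i
    using that by (intro coeff_eq_0) linarith
  then have "?p = 0 \<longleftrightarrow> (\<forall>i<?n. coeff ?p i = 0)"
    unfolding poly_eq_iff coeff_0 by blast
  then show ?thesis
    unfolding p by (simp add: vec_eq_iff)
qed

lemma bezoutian_eq_0_iff_vec:
  fixes P S :: "'a::field_char_0 poly"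
  assumes "degree S \<le> degree P" "degree P > 0"
  shows "bezoutian P S = 0 \<longleftrightarrow> (\<exists>v \<in> carrier_vec (degree P). v \<noteq> 0\<^sub>v (degree P) \<and>
    (\<Sum>j<degree P. smult (v $ j) (coeff (bezout_quotient P S) j)) = 0)"
proof -
  have "bezout_mat P S \<in> carrier_mat (degree P) (degree P)"
    using assms by (simp add: bezout_mat_def Let_def max_absorb1)
  from det_0_iff_vec_prod_zero_field[OF this] show ?thesis
    using bezout_mat_mult_vec_eq_0_iff[OF assms] by (auto simp: bezoutian_def)
qed

lemma bezoutian_eq_0_if_common_root:
  fixes P S :: "'a::field_char_0 poly"
  assumes "degree S \<le> degree P" "degree P > 0" "poly P z = 0" "poly S z = 0"
  shows "bezoutian P S = 0"
proof -
  let ?p = "\<Sum>j<degree P. smult (z ^ j) (coeff (bezout_quotient P S) j)"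
  have ev: "(\<Sum>j\<le>degree P. z ^ j * coeff R j) = poly R z" if "degree R \<le> degree P" for R
    using poly_eq_sum_atMost[OF that] by (simp add: mult.commute)
  \<comment> \<open>With weights z^j the left side of \<open>bezout_quotient_weighted_sum\<close>
    becomes (x - z) \<open>?p\<close>, and the right side vanishes since P(z) = S(z) = 0.\<close>
  have "[:- z, 1:] * ?p = pCons 0 ?p - smult z ?p"
    by simp
  also have "smult z ?p = (\<Sum>j<degree P. smult (z ^ Suc j) (coeff (bezout_quotient P S) j))"
    by (simp add: smult_sum2)
  also have "pCons 0 ?p - \<dots> = 0"
    using assms by (simp only: bezout_quotient_weighted_sum ev) simp
  finally have "?p = 0"
    by (simp del: mult_pCons_left)
  moreover have "vec (degree P) (\<lambda>j. z ^ j) \<noteq> 0\<^sub>v (degree P)"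
    using assms(2) by (auto simp: vec_eq_iff intro!: exI[of _ 0])
  ultimately show ?thesis
    using assms(1,2) by (auto simp: bezoutian_eq_0_iff_vec intro!: bexI[of _ "vec (degree P) (\<lambda>j. z ^ j)"])
qed

lemma bezoutian_neq_0_if_bezout_identity:
  fixes P S u w :: "'a::field_char_0 poly"
  assumes deg: "degree S \<le> degree P" "degree P > 0" and one: "u * P + w * S = 1"
  shows "bezoutian P S \<noteq> 0"
proof
  let ?n = "degree P" and ?b = "coeff (bezout_quotient P S)"
  assume "bezoutian P S = 0"
  then obtain v where v: "v \<in> carrier_vec ?n" "v \<noteq> 0\<^sub>v ?n"
    and ker: "(\<Sum>j<?n. smult (v $ j) (?b j)) = 0"
    using deg by (auto simp: bezoutian_eq_0_iff_vec)
  \<comment> \<open>Reduction modulo P extends the functional from degrees below \<open>?n\<close>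
    to all polynomials and makes it vanish on multiples of P.\<close>
  define L where "L h = (\<Sum>j<?n. v $ j * coeff (h mod P) j)" for h
  have L_add: "L (h + k) = L h + L k" for h k
    by (simp add: L_def poly_mod_add_left algebra_simps sum.distrib)
  have L_smult: "L (smult a h) = a * L h" for a h
    by (simp add: L_def mod_smult_left sum_distrib_left algebra_simps)
  have L_0: "L 0 = 0"
    by (simp add: L_def)
  have L_sum: "L (\<Sum>i\<in>A. h i) = (\<Sum>i\<in>A. L (h i))" for A :: "nat set" and h
    by (induction A rule: infinite_finite_induct) (simp_all add: L_add L_0)
  have L_P: "L (h * P) = 0" for h
    by (simp add: L_def)
  have L_monom: "L (monom 1 j) = v $ j" if "j < ?n" for j
  proof -
    have "monom 1 j mod P = monom 1 j"
      using that by (intro mod_poly_less) (simp add: degree_monom_eq)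
    with that show ?thesis
      by (simp add: L_def if_distrib[of "(*) _"] cong: if_cong)
  qed
  \<comment> \<open>The sum runs to \<open>?n\<close> rather than to the degree of h, to match
    \<open>bezout_quotient_weighted_sum\<close> for both P and S.\<close>
  have L_mult: "L (monom 1 m * h) = (\<Sum>j\<le>?n. L (monom 1 (m + j)) * coeff h j)"
    if "degree h \<le> ?n" for m h
  proof -
    have "L (monom 1 m * h) = L (\<Sum>j\<le>?n. smult (coeff h j) (monom 1 (m + j)))"
      by (subst poly_as_sum_of_monoms'[OF that, symmetric])
        (simp add: sum_distrib_left mult_monom smult_monom)
    then show ?thesis
      by (simp add: L_sum L_smult mult.commute)
  qed
  \<comment> \<open>The weights are those of the shifted functional sending h to L(y^m h);
    \<open>p 0\<close> is the polynomial in \<open>ker\<close>.\<close>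
  define p where "p m = (\<Sum>j<?n. smult (L (monom 1 (m + j))) (?b j))" for m
  have deg_p: "degree (p m) < ?n" for m
    unfolding p_def using deg degree_coeff_bezout_quotient[OF deg]
    by (intro degree_sum_less) (auto intro: le_less_trans[OF degree_smult_le])
  have step: "pCons 0 (p m) - p (Suc m) = smult (L (monom 1 m * S)) P" for m
    using bezout_quotient_weighted_sum[OF deg(1), of "\<lambda>j. L (monom 1 (m + j))"]
    by (simp add: p_def L_mult[symmetric] deg L_P)
  have zero: "L (monom 1 m * S) = 0 \<and> p (Suc m) = 0" if "p m = 0" for m
  proof -
    have eq: "smult (L (monom 1 m * S)) P = - p (Suc m)"
      using step[of m] that by simp
    \<comment> \<open>A nonzero scalar multiple of P would have degree \<open>?n\<close>, so the
      scalar is zero.\<close>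
    then have "degree (smult (L (monom 1 m * S)) P) < ?n"
      using deg_p[of "Suc m"] by simp
    then have "L (monom 1 m * S) = 0"
      by (auto split: if_splits)
    with eq show ?thesis by simp
  qed
  have "p m = 0" for m
  proof (induction m)
    case 0
    then show ?case using ker by (simp add: p_def L_monom)
  qed (simp add: zero)
  then have "L (monom 1 m * S) = 0" for m
    using zero by blast
  then have L_S: "L (h * S) = 0" for h
  proof -
    have "L (monom a m * S) = 0" for a m
      using \<open>L (monom 1 m * S) = 0\<close> L_smult[of a "monom 1 m * S"]
      by (simp add: smult_monom flip: mult_smult_left)
    then show ?thesis
      by (subst poly_as_sum_of_monoms[symmetric]) (simp add: sum_distrib_right L_sum)
  qed
  have "L h = 0" for h
  proof -
    have "h = h * u * P + h * w * S"
      using one by (metis distrib_left mult.assoc mult.right_neutral)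
    then show ?thesis
      by (metis L_add L_P L_S add_0)
  qed
  then show False
    using v L_monom by (auto simp: vec_eq_iff)
qed

section \<open>Common roots of complex polynomials\<close>

lemma degree_gcd_neq_0_iff_common_root:
  fixes f g :: "complex poly"
  assumes "f \<noteq> 0"
  shows "degree (gcd f g) \<noteq> 0 \<longleftrightarrow> (\<exists>z. poly f z = 0 \<and> poly g z = 0)"
proof
  assume "degree (gcd f g) \<noteq> 0"
  then obtain z where "poly (gcd f g) z = 0"
    using fundamental_theorem_of_algebra by (metis constant_degree)
  then show "\<exists>z. poly f z = 0 \<and> poly g z = 0"
    by (meson dvd_trans gcd_dvd1 gcd_dvd2 poly_eq_0_iff_dvd)
next
  assume "\<exists>z. poly f z = 0 \<and> poly g z = 0"
  then obtain z where "[:- z, 1:] dvd gcd f g"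
    by (auto simp: poly_eq_0_iff_dvd)
  moreover have "gcd f g \<noteq> 0"
    using assms by simp
  ultimately have "degree [:- z, 1:] \<le> degree (gcd f g)"
    by (rule dvd_imp_degree_le)
  then show "degree (gcd f g) \<noteq> 0"
    by simp
qed

lemma bezoutian_eq_0_iff_common_root:
  fixes f g :: "complex poly"
  assumes "degree g \<le> degree f" "degree f > 0"
  shows "bezoutian f g = 0 \<longleftrightarrow> (\<exists>z. poly f z = 0 \<and> poly g z = 0)"
proof
  assume 0: "bezoutian f g = 0"
  show "\<exists>z. poly f z = 0 \<and> poly g z = 0"
  proof (rule ccontr)
    assume "\<nexists>z. poly f z = 0 \<and> poly g z = 0"
    moreover have "f \<noteq> 0"
      using assms by auto
    ultimately have "degree (gcd f g) = 0" "f \<noteq> 0"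
      using degree_gcd_neq_0_iff_common_root by blast+
    \<comment> \<open>A nonzero constant is a unit, and the gcd is normalized.\<close>
    then have "gcd f g = 1"
      by (metis gcd_eq_0_iff is_unit_gcd_iff is_unit_iff_degree)
    then obtain u w where "u * f + w * g = 1"
      by (metis bezout_coefficients_fst_snd)
    from bezoutian_neq_0_if_bezout_identity[OF assms this] 0 show False
      by simp
  qed
qed (use assms bezoutian_eq_0_if_common_root in blast)

section \<open>Quaternionic polynomials at complex points\<close>

lemma quat_of_complex_power: "quat_of_complex (z ^ i) = quat_of_complex z ^ i"
  by (induction i) (simp_all add: quat_of_complex_hom)

lemma quat_of_complex_sum: "quat_of_complex (sum h A) = (\<Sum>i\<in>A. quat_of_complex (h i))"
  by (induction A rule: infinite_finite_induct) (simp_all add: quat_of_complex_hom)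

text \<open>Left multiplication by k sends complex numbers into the span of j and k, which meets the
  complex numbers only in 0.\<close>

lemma quat_of_complex_add_k_eq_iff:
  "quat_of_complex a + quat_k * quat_of_complex b = quat_of_complex c \<longleftrightarrow> a = c \<and> b = 0"
  by (auto simp: quat_eq_iff plus_quat_def times_quat_def quat_k_def quat_of_complex_def
      complex_eq_iff)

text \<open>Since k stands to the left of the coefficients and powers to their right, it factors out
  by associativity alone.\<close>

lemma quat_poly_eval_of_complex:
  assumes Q: "Q = quat_poly_of_complex f + quat_left_smult quat_k (quat_poly_of_complex g)"
    and deg: "degree f \<le> degree Q" "degree g \<le> degree Q"
  shows "quat_poly_eval Q (quat_of_complex z)
    = quat_of_complex (poly f z) + quat_k * quat_of_complex (poly g z)"
proof -
  have "coeff Q i = quat_of_complex (coeff f i) + quat_k * quat_of_complex (coeff g i)" for i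
    by (simp add: Q)
  then show ?thesis
    unfolding quat_poly_eval_def poly_eq_sum_atMost[OF deg(1)] poly_eq_sum_atMost[OF deg(2)]
    by (simp add: quat_of_complex_sum quat_of_complex_hom quat_of_complex_power
        distrib_right mult.assoc sum.distrib sum_distrib_left)
qed

theorem corollary1:
  fixes Q :: "quat poly" and f g :: "complex poly" and n :: nat
  assumes "Q \<notin> complex_quat_polys"
    and "degree Q = n" and "n \<ge> 1" and "lead_coeff Q = 1"
    and "Q = quat_poly_of_complex f + quat_left_smult quat_k (quat_poly_of_complex g)"
  shows "((\<exists>q\<in>complex_quats. quat_poly_eval Q q = 0) \<longleftrightarrow> resultant f g = 0) \<and>
         ((\<exists>q\<in>complex_quats. quat_poly_eval Q q = 0) \<longleftrightarrow> bezoutian f g = 0)"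
proof -
  have cQ: "coeff Q i = quat_of_complex (coeff f i) + quat_k * quat_of_complex (coeff g i)" for i
    by (simp add: assms(5))
  have high: "coeff f i = 0 \<and> coeff g i = 0" if "i > n" for i
    using cQ[of i] that assms(2) quat_of_complex_add_k_eq_iff[of "coeff f i" "coeff g i" 0]
    by (simp add: coeff_eq_0)
  \<comment> \<open>Splitting the leading coefficient 1 of Q fixes the degree of f at n, so f can
    serve as the argument of larger degree in the Bezoutian.\<close>
  have lead: "coeff f n = 1 \<and> coeff g n = 0"
    using cQ[of n] assms(2,4) quat_of_complex_add_k_eq_iff[of "coeff f n" "coeff g n" 1]
    by (simp add: quat_of_complex_hom)
  have "degree f \<le> n" "degree g \<le> n"
    using high by (auto intro: degree_le)
  with lead have deg: "degree f = n" "degree g \<le> n"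
    using le_degree[of f n] by auto
  have roots: "(\<exists>q\<in>complex_quats. quat_poly_eval Q q = 0) \<longleftrightarrow> (\<exists>z. poly f z = 0 \<and> poly g z = 0)"
    using quat_of_complex_add_k_eq_iff[of _ _ 0] deg assms(2)
    by (simp add: complex_quats_def quat_poly_eval_of_complex[OF assms(5)])
  have "f \<noteq> 0"
    using deg assms(3) by auto
  then have "resultant f g = 0 \<longleftrightarrow> (\<exists>z. poly f z = 0 \<and> poly g z = 0)"
    unfolding resultant_0_gcd by (rule degree_gcd_neq_0_iff_common_root)
  moreover have "bezoutian f g = 0 \<longleftrightarrow> (\<exists>z. poly f z = 0 \<and> poly g z = 0)"
    using deg assms(3) by (intro bezoutian_eq_0_iff_common_root) auto
  ultimately show ?thesis
    using roots by blast
qed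

end
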